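(* There exists a simple closed smooth curve $\gamma$ in $\mathbb{D}^*$, homologous in $\mathbb{D}^*$ to the circle $C_r=\{|z|=r\}$ ($0<r<1$), such that (i) $\displaystyle\oint_\gamma \kappa_g\,d(\mathrm{length})>2\pi$; (ii) $ds^*$ has no negatively curved completion across $\gamma$.
   Context: $\mathbb{D}=\{z\in\mathbb{C}: |z|<1\}$ and $\mathbb{D}^*=\{z\in\mathbb{C}: 0<|z|<1\}$. The metric $ds^*=-\frac{1}{|z|\log|z|}\,|dz|$ is the complete hyperbolic (curvature $-1$) metric on $\mathbb{D}^*$ conformally equivalent to the Euclidean metric. For a simple closed curve $\gamma$ around $0$ in $\mathbb{D}^*$, $\kappa_g$ is the geodesic curvature of $\gamma$ and $d(\mathrm{length})$ its length element, both with respect to $ds^*$; the sign of $\kappa_g$ is taken with respect to the normal pointing into the component of $\mathbb{D}^*\setminus\gamma$ adjacent to $0$ (so circles centered at $0$ have $\kappa_g=1$). Let $R\subset\mathbb{D}$ be the bounded region enclosed by $\gamma$ (it contains $0$). A negatively curved completion of $ds^*$ across $\gamma=\partial R$ is a Riemannian metric $ds$ on $\mathbb{D}$ such that: $ds$ is conformally equivalent to $ds^*$, i.e. $ds=e^{u}|dz|$ with $u$ real of class $C^2$ on $\mathbb{D}$; $ds=ds^*$ on $\mathbb{D}\setminus R$; and its Gaussian curvature satisfies $\kappa(ds)<0$ on $\mathbb{D}$. *)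

theory Defs
  imports "HOL-Complex_Analysis.Complex_Analysis" "HOL-Homology.Homology"
begin

section \<open>Riemannian geometry on open subsets of the plane\<close>

text \<open>A metric tensor \<open>g\<close> assigns to a point \<open>p\<close> and two tangent vectors \<open>v\<close>, \<open>w\<close> at \<open>p\<close> the
  inner product \<open>g p v w\<close>. Only the values at points of the region under consideration matter.\<close>

type_synonym metric_tensor = "complex \<Rightarrow> complex \<Rightarrow> complex \<Rightarrow> real"

text \<open>The metric written \<open>ds = \<rho> |dz|\<close>.\<close>

definition conformal_metric :: "(complex \<Rightarrow> real) \<Rightarrow> metric_tensor" where
  "conformal_metric \<rho> p v w = (\<rho> p)\<^sup>2 * (v \<bullet> w)"

text \<open>\<open>metric_deriv g p x v w\<close> is the derivative at \<open>p\<close> in direction \<open>x\<close> of the function \<open>g(V,W)\<close>,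
  where \<open>V\<close>, \<open>W\<close> are the constant vector fields with values \<open>v\<close>, \<open>w\<close>.\<close>

definition metric_deriv :: "metric_tensor \<Rightarrow> complex \<Rightarrow> complex \<Rightarrow> complex \<Rightarrow> complex \<Rightarrow> real" where
  "metric_deriv g p x v w = frechet_derivative (\<lambda>q. g q v w) (at p) x"

text \<open>\<open>christoffel g p v w\<close> is the value at \<open>p\<close> of \<open>\<nabla>\<^bsub>V\<^esub> W\<close> for constant fields \<open>V\<close>, \<open>W\<close> and the
  Levi-Civita connection \<open>\<nabla>\<close> of \<open>g\<close>, characterised by the Koszul formula.\<close>

definition christoffel :: "metric_tensor \<Rightarrow> complex \<Rightarrow> complex \<Rightarrow> complex \<Rightarrow> complex" where
  "christoffel g p v w =
     (THE a. \<forall>z. 2 * g p a z = metric_deriv g p v w z + metric_deriv g p w v z - metric_deriv g p z v w)"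

text \<open>\<open>\<nabla>\<^bsub>X\<^esub>\<nabla>\<^bsub>Y\<^esub> Z - \<nabla>\<^bsub>Y\<^esub>\<nabla>\<^bsub>X\<^esub> Z\<close> for constant (hence commuting) fields \<open>X\<close>, \<open>Y\<close>, \<open>Z\<close>.\<close>

definition riemann_curvature ::
    "metric_tensor \<Rightarrow> complex \<Rightarrow> complex \<Rightarrow> complex \<Rightarrow> complex \<Rightarrow> complex" where
  "riemann_curvature g p x y z =
     frechet_derivative (\<lambda>q. christoffel g q y z) (at p) x
   - frechet_derivative (\<lambda>q. christoffel g q x z) (at p) y
   + christoffel g p x (christoffel g p y z)
   - christoffel g p y (christoffel g p x z)"

definition gauss_curvature :: "metric_tensor \<Rightarrow> complex \<Rightarrow> real" where
  "gauss_curvature g p =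
     g p (riemann_curvature g p 1 \<i> \<i>) 1 / (g p 1 1 * g p \<i> \<i> - (g p 1 \<i>)\<^sup>2)"

definition velocity :: "(real \<Rightarrow> complex) \<Rightarrow> real \<Rightarrow> complex" where
  "velocity \<gamma> t = vector_derivative \<gamma> (at t)"

text \<open>The covariant derivative of the velocity field along the curve.\<close>

definition covariant_acceleration :: "metric_tensor \<Rightarrow> (real \<Rightarrow> complex) \<Rightarrow> real \<Rightarrow> complex" where
  "covariant_acceleration g \<gamma> t =
     velocity (velocity \<gamma>) t + christoffel g (\<gamma> t) (velocity \<gamma> t) (velocity \<gamma> t)"

definition speed :: "metric_tensor \<Rightarrow> (real \<Rightarrow> complex) \<Rightarrow> real \<Rightarrow> real" where
  "speed g \<gamma> t = sqrt (g (\<gamma> t) (velocity \<gamma> t) (velocity \<gamma> t))"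

text \<open>Geodesic curvature \<open>g(\<nabla>\<^bsub>T\<^esub> T, N)\<close> with respect to a unit normal \<open>N\<close>. For the unit tangent
  \<open>T = \<gamma>' / |\<gamma>'|\<close> of an arbitrary regular parametrisation, \<open>\<nabla>\<^bsub>T\<^esub> T\<close> and
  \<open>\<nabla>\<^bsub>\<gamma>'\<^esub> \<gamma>' / |\<gamma>'|\<^sup>2\<close> differ by a tangential vector only.\<close>

definition geodesic_curvature ::
    "metric_tensor \<Rightarrow> (real \<Rightarrow> complex) \<Rightarrow> (real \<Rightarrow> complex) \<Rightarrow> real \<Rightarrow> real" where
  "geodesic_curvature g \<gamma> N t = g (\<gamma> t) (covariant_acceleration g \<gamma> t) (N t) / (speed g \<gamma> t)\<^sup>2"

definition C2_on :: "complex set \<Rightarrow> (complex \<Rightarrow> real) \<Rightarrow> bool" where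
  "C2_on S u \<longleftrightarrow>
     (\<exists>(u' :: complex \<Rightarrow> complex \<Rightarrow>\<^sub>L real) (u'' :: complex \<Rightarrow> complex \<Rightarrow>\<^sub>L (complex \<Rightarrow>\<^sub>L real)).
        (\<forall>p\<in>S. (u has_derivative blinfun_apply (u' p)) (at p)) \<and>
        (\<forall>p\<in>S. (u' has_derivative blinfun_apply (u'' p)) (at p)) \<and>
        continuous_on S u'')"


section \<open>Curves in the punctured disc\<close>

definition unit_disc :: "complex set" where
  "unit_disc = {z. cmod z < 1}"

definition punctured_disc :: "complex set" where
  "punctured_disc = {z. 0 < cmod z \<and> cmod z < 1}"

definition cusp_metric :: metric_tensor where
  "cusp_metric = conformal_metric (\<lambda>z. - 1 / (cmod z * ln (cmod z)))"

text \<open>Simple closed curves that are smooth also at the base point: they are given by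
  1-periodic smooth immersions of the real line that are injective on a period.\<close>

definition smooth_simple_closed_curve :: "(real \<Rightarrow> complex) \<Rightarrow> bool" where
  "smooth_simple_closed_curve \<gamma> \<longleftrightarrow>
     (\<forall>t. \<gamma> (t + 1) = \<gamma> t) \<and>
     (\<forall>k t. (velocity ^^ k) \<gamma> differentiable (at t)) \<and>
     (\<forall>t. velocity \<gamma> t \<noteq> 0) \<and>
     simple_path \<gamma>"

text \<open>A path as a singular 1-chain; \<open>x 1\<close> is the parameter on the standard 1-simplex.\<close>

definition path_chain :: "(real \<Rightarrow> complex) \<Rightarrow> complex chain" where
  "path_chain \<gamma> = frag_of (restrict (\<lambda>x. \<gamma> (x 1)) (standard_simplex 1))"

definition homologous_in :: "complex set \<Rightarrow> (real \<Rightarrow> complex) \<Rightarrow> (real \<Rightarrow> complex) \<Rightarrow> bool" where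
  "homologous_in S \<gamma> \<eta> \<longleftrightarrow>
     homologous_rel 1 (top_of_set S) {} (path_chain \<gamma>) (path_chain \<eta>)"

text \<open>The component of the complement of the curve in the punctured disc that is adjacent to \<open>0\<close>.\<close>

definition cusp_side :: "(real \<Rightarrow> complex) \<Rightarrow> complex set" where
  "cusp_side \<gamma> = (THE A. A \<in> components (punctured_disc - path_image \<gamma>) \<and> 0 \<in> closure A)"

definition cusp_normal :: "(real \<Rightarrow> complex) \<Rightarrow> real \<Rightarrow> complex" where
  "cusp_normal \<gamma> t =
     (THE n. cusp_metric (\<gamma> t) n n = 1 \<and> cusp_metric (\<gamma> t) n (velocity \<gamma> t) = 0 \<and>
             (\<forall>\<^sub>F \<epsilon> in at_right 0. \<gamma> t + \<epsilon> *\<^sub>R n \<in> cusp_side \<gamma>))"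

definition total_geodesic_curvature :: "(real \<Rightarrow> complex) \<Rightarrow> real" where
  "total_geodesic_curvature \<gamma> =
     integral {0..1}
       (\<lambda>t. geodesic_curvature cusp_metric \<gamma> (cusp_normal \<gamma>) t * speed cusp_metric \<gamma> t)"

definition negatively_curved_completion :: "(real \<Rightarrow> complex) \<Rightarrow> metric_tensor \<Rightarrow> bool" where
  "negatively_curved_completion \<gamma> g \<longleftrightarrow>
     (\<exists>u. C2_on unit_disc u \<and> (\<forall>p\<in>unit_disc. g p = conformal_metric (\<lambda>z. exp (u z)) p)) \<and>
     (\<forall>p\<in>unit_disc - inside (path_image \<gamma>). g p = cusp_metric p) \<and>
     (\<forall>p\<in>unit_disc. gauss_curvature g p < 0)"

end

theory Submission
  imports Defs
begin

text \<open>
  A metric \<open>e\<^sup>u |dz|\<close> has curvature \<open>- e\<^sup>-\<^sup>2\<^sup>u \<Delta> u\<close>, so the exponent \<open>u\<close> of a negatively curved completion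
  has positive Laplacian and takes its maximum over the closed region bounded by the curve on the
  curve itself. On the curve, to first order, \<open>u\<close> agrees with the exponent
  \<open>u\<^sup>* = - log |z| - log (- log |z|)\<close> of the cusp metric. This yields an obstruction: no completion
  exists if \<open>u\<^sup>*\<close>, restricted to the curve, is maximal at a point where \<open>u\<^sup>*\<close> increases into the
  region. With \<open>x = - log |z|\<close> the exponent is \<open>x - log x\<close>, which increases towards the cusp where
  \<open>x > 1\<close>; so the curve has to come close to 0 in one direction, and must not come so close to
  the unit circle elsewhere that \<open>u\<^sup>*\<close> becomes larger there.

  This is compatible with a large total curvature. For a curve \<open>- log |z| = f (arg z)\<close> the
  total geodesic curvature is the integral of \<open>1 / f\<close> over a period, which is also the hyperbolic area of
  the enclosed cusp. The choice \<open>1 / f = 5 / 4 + cos\<close> gives the value \<open>5 \<pi> / 2\<close>, computed in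
  \<open>total_geodesic_curvature_loop\<close>. Here \<open>f\<close> ranges between 4/9 and 4, and the convex function
  \<open>x - log x\<close> is larger at 4 than at 4/9, so the obstruction applies at the point of argument \<open>\<pi>\<close>. This is the content of
  \<open>no_negatively_curved_completion_loop\<close>.
\<close>

section \<open>Curvature of conformal metrics\<close>

text \<open>In the Koszul formula every derivative of the metric \<open>e\<^sup>2\<^sup>u (v \<bullet> w)\<close> produces a factor
  \<open>2 e\<^sup>2\<^sup>u\<close>, which cancels against the metric on the left; only the gradient \<open>G\<close> of \<open>u\<close> at the point
  remains.\<close>

lemma christoffel_conformal:
  fixes u :: "complex \<Rightarrow> real"
  assumes S: "open S" "p \<in> S"
    and g: "\<And>q. q \<in> S \<Longrightarrow> g q = conformal_metric (\<lambda>z. exp (u z)) q"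
    and u: "(u has_derivative (\<lambda>h. G \<bullet> h)) (at p)"
  shows "christoffel g p v w = (G \<bullet> v) *\<^sub>R w + (G \<bullet> w) *\<^sub>R v - (v \<bullet> w) *\<^sub>R G" (is "_ = ?c")
proof -
  define E where "E = (exp (u p))\<^sup>2"
  have E: "E > 0" by (simp add: E_def)
  have md: "metric_deriv g p x a b = 2 * E * (G \<bullet> x) * (a \<bullet> b)" for x a b
  proof -
    have "((\<lambda>q. (exp (u q))\<^sup>2 * (a \<bullet> b)) has_derivative (\<lambda>x. 2 * E * (G \<bullet> x) * (a \<bullet> b))) (at p)"
      by (rule derivative_eq_intros u refl)+ (auto simp: E_def power2_eq_square)
    then have "((\<lambda>q. g q a b) has_derivative (\<lambda>x. 2 * E * (G \<bullet> x) * (a \<bullet> b))) (at p)"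
      by (rule has_derivative_transform_within_open[OF _ S]) (simp add: g conformal_metric_def)
    then show ?thesis
      by (simp add: metric_deriv_def frechet_derivative_at[symmetric])
  qed
  have gp: "g p a b = E * (a \<bullet> b)" for a b
    using S by (simp add: g conformal_metric_def E_def)
  show ?thesis
    unfolding christoffel_def
  proof (rule the_equality)
    show "\<forall>z. 2 * g p ?c z = metric_deriv g p v w z + metric_deriv g p w v z - metric_deriv g p z v w"
      unfolding md gp by (auto simp: inner_simps algebra_simps inner_commute)
  next
    fix a assume a: "\<forall>z. 2 * g p a z = metric_deriv g p v w z + metric_deriv g p w v z - metric_deriv g p z v w"
    have "E * ((a - ?c) \<bullet> z) = 0" for z
      using a[rule_format, of z] unfolding md gp
      by (simp add: inner_simps algebra_simps inner_commute)
    then have "(a - ?c) \<bullet> (a - ?c) = 0" using E by (metis less_irrefl mult_eq_0_iff)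
    then show "a = ?c" by simp
  qed
qed

text \<open>The classical formula \<open>K = - e\<^sup>-\<^sup>2\<^sup>u \<Delta> u\<close>: the terms quadratic in the gradient \<open>G\<close> cancel in the
  component of the curvature tensor in question, and the trace of the derivative \<open>G'\<close> of the gradient
  is the Laplacian.\<close>

lemma gauss_curvature_conformal:
  fixes u :: "complex \<Rightarrow> real" and G :: "complex \<Rightarrow> complex"
  assumes S: "open S" "p \<in> S"
    and g: "\<And>q. q \<in> S \<Longrightarrow> g q = conformal_metric (\<lambda>z. exp (u z)) q"
    and u: "\<And>q. q \<in> S \<Longrightarrow> (u has_derivative (\<lambda>h. G q \<bullet> h)) (at q)"
    and G: "(G has_derivative G') (at p)"
  shows "gauss_curvature g p = - (G' 1 \<bullet> 1 + G' \<i> \<bullet> \<i>) / (exp (u p))\<^sup>2"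
proof -
  have chr: "christoffel g q v w = (G q \<bullet> v) *\<^sub>R w + (G q \<bullet> w) *\<^sub>R v - (v \<bullet> w) *\<^sub>R G q"
    if "q \<in> S" for q v w
    by (rule christoffel_conformal[OF S(1) that g u[OF that]])
  have fd: "frechet_derivative (\<lambda>q. christoffel g q v w) (at p) x
      = (G' x \<bullet> v) *\<^sub>R w + (G' x \<bullet> w) *\<^sub>R v - (v \<bullet> w) *\<^sub>R G' x" for v w x
  proof -
    have "((\<lambda>q. (G q \<bullet> v) *\<^sub>R w + (G q \<bullet> w) *\<^sub>R v - (v \<bullet> w) *\<^sub>R G q) has_derivative
        (\<lambda>x. (G' x \<bullet> v) *\<^sub>R w + (G' x \<bullet> w) *\<^sub>R v - (v \<bullet> w) *\<^sub>R G' x)) (at p)"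
      by (auto intro!: derivative_eq_intros G)
    then have "((\<lambda>q. christoffel g q v w) has_derivative
        (\<lambda>x. (G' x \<bullet> v) *\<^sub>R w + (G' x \<bullet> w) *\<^sub>R v - (v \<bullet> w) *\<^sub>R G' x)) (at p)"
      by (rule has_derivative_transform_within_open[OF _ S]) (simp add: chr)
    then show ?thesis by (simp add: frechet_derivative_at[symmetric])
  qed
  have gp: "g p a b = (exp (u p))\<^sup>2 * (a \<bullet> b)" for a b
    using S by (simp add: g conformal_metric_def)
  have "riemann_curvature g p 1 \<i> \<i> \<bullet> 1 = - (G' 1 \<bullet> 1 + G' \<i> \<bullet> \<i>)"
    unfolding riemann_curvature_def fd chr[OF S(2)]
    by (simp add: inner_complex_def algebra_simps)
  then show ?thesis
    by (simp add: gauss_curvature_def gp inner_complex_def power2_eq_square)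
qed

text \<open>Turns the derivatives with values in spaces of bounded linear maps into a gradient vector field
  and its derivative, by representing a linear functional by a vector.\<close>

lemma C2_on_gradient:
  assumes "C2_on S u"
  obtains G G' where "\<And>q. q \<in> S \<Longrightarrow> (u has_derivative (\<lambda>h. G q \<bullet> h)) (at q)"
    "\<And>q. q \<in> S \<Longrightarrow> (G has_derivative G' q) (at q)"
proof -
  from assms obtain u' :: "complex \<Rightarrow> complex \<Rightarrow>\<^sub>L real" and u'' where
    u': "\<And>q. q \<in> S \<Longrightarrow> (u has_derivative blinfun_apply (u' q)) (at q)" and
    u'': "\<And>q. q \<in> S \<Longrightarrow> (u' has_derivative blinfun_apply (u'' q)) (at q)"
    unfolding C2_on_def by blast
  define L :: "(complex \<Rightarrow>\<^sub>L real) \<Rightarrow> complex" where "L = (\<lambda>f. f 1 *\<^sub>R 1 + f \<i> *\<^sub>R \<i>)"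
  have L: "bounded_linear L" unfolding L_def
    by (intro bounded_linear_add bounded_linear_scaleR_const blinfun.bounded_linear_left)
  have app: "blinfun_apply f h = L f \<bullet> h" for f :: "complex \<Rightarrow>\<^sub>L real" and h
  proof -
    have "blinfun_apply f h = f (Re h *\<^sub>R 1 + Im h *\<^sub>R \<i>)"
      by (rule arg_cong[where f = "blinfun_apply f"]) (simp add: complex_eq_iff)
    then show ?thesis
      by (simp add: blinfun.add_right blinfun.scaleR_right L_def inner_complex_def)
  qed
  show thesis
  proof (rule that[of "\<lambda>q. L (u' q)" "\<lambda>q h. L (u'' q h)"])
    fix q assume q: "q \<in> S"
    show "(u has_derivative (\<lambda>h. L (u' q) \<bullet> h)) (at q)"
      using u'[OF q] by (simp add: app[abs_def])
    show "((\<lambda>q. L (u' q)) has_derivative (\<lambda>h. L (u'' q h))) (at q)"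
      using bounded_linear.has_derivative[OF L u''[OF q]] .
  qed
qed

section \<open>A maximum principle\<close>

lemma second_derivative_nonpos_at_local_max:
  fixes h h' :: "real \<Rightarrow> real"
  assumes d: "0 < d" and h: "\<And>t. \<bar>t\<bar> < d \<Longrightarrow> (h has_real_derivative h' t) (at t)"
    and h': "(h' has_real_derivative l) (at 0)"
    and max: "\<And>t. \<bar>t\<bar> < d \<Longrightarrow> h t \<le> h 0"
  shows "l \<le> 0"
proof (rule ccontr)
  assume "\<not> l \<le> 0"
  then have "l > 0" by simp
  have z: "h' 0 = 0"
    using DERIV_local_max[OF h[of 0] d] max d by auto
  obtain e where e: "e > 0" "\<And>t. 0 < t \<Longrightarrow> t < e \<Longrightarrow> h' t > 0"
    using DERIV_pos_inc_right[OF h' \<open>l > 0\<close>] z by auto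
  define s where "s = min d e / 2"
  have s: "0 < s" "s < d" "s < e" using d e(1) by (auto simp: s_def)
  have "\<exists>t>0. t < s \<and> h s - h 0 = (s - 0) * h' t"
    by (rule MVT2) (use s in \<open>auto intro!: h\<close>)
  then obtain t where "0 < t" "t < s" "h s - h 0 = s * h' t" by auto
  with e(2)[of t] s have "h s > h 0" by (smt (verit) mult_pos_pos)
  with max[of s] s show False by simp
qed

text \<open>At a local maximum the second derivatives along both coordinate axes are nonpositive, hence so is
  their sum, the Laplacian. This is the only form of the maximum principle that strictly negative
  curvature calls for.\<close>

lemma no_local_max_of_laplacian_pos:
  fixes u :: "complex \<Rightarrow> real" and G :: "complex \<Rightarrow> complex"
  assumes S: "open S" "p \<in> S"
    and u: "\<And>q. q \<in> S \<Longrightarrow> (u has_derivative (\<lambda>h. G q \<bullet> h)) (at q)"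
    and G: "(G has_derivative G') (at p)"
    and lap: "G' 1 \<bullet> 1 + G' \<i> \<bullet> \<i> > 0"
  shows "\<exists>q\<in>S. u q > u p"
proof (rule ccontr)
  assume "\<not> ?thesis"
  then have max: "u q \<le> u p" if "q \<in> S" for q using that by force
  have *: "G' e \<bullet> e \<le> 0" if e: "norm e = 1" for e
  proof -
    obtain d where d: "d > 0" "ball p d \<subseteq> S" using S openE by blast
    have inS: "p + t *\<^sub>R e \<in> S" if "\<bar>t\<bar> < d" for t
      using d(2) that e by (auto simp: dist_norm)
    show ?thesis
    proof (rule second_derivative_nonpos_at_local_max[OF d(1), where h = "\<lambda>t. u (p + t *\<^sub>R e)"
          and h' = "\<lambda>t. G (p + t *\<^sub>R e) \<bullet> e"])
      fix t :: real assume t: "\<bar>t\<bar> < d"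
      have "((\<lambda>t. u (p + t *\<^sub>R e)) has_derivative (\<lambda>h. G (p + t *\<^sub>R e) \<bullet> (h *\<^sub>R e))) (at t)"
        by (rule has_derivative_compose[where g = u and f = "\<lambda>t. p + t *\<^sub>R e", OF _ u[OF inS[OF t]]])
          (auto intro!: derivative_eq_intros)
      then show "((\<lambda>t. u (p + t *\<^sub>R e)) has_real_derivative G (p + t *\<^sub>R e) \<bullet> e) (at t)"
        by (simp add: has_field_derivative_def mult_commute_abs)
      show "u (p + t *\<^sub>R e) \<le> u (p + 0 *\<^sub>R e)" using max[OF inS[OF t]] by simp
    next
      have G0: "(G has_derivative G') (at (p + 0 *\<^sub>R e))" using G by simp
      have 1: "((\<lambda>t. G (p + t *\<^sub>R e)) has_derivative (\<lambda>h. G' (h *\<^sub>R e))) (at 0)"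
        by (rule has_derivative_compose[where g = G and f = "\<lambda>t. p + t *\<^sub>R e", OF _ G0]) (auto intro!: derivative_eq_intros)
      have "((\<lambda>t. G (p + t *\<^sub>R e) \<bullet> e) has_derivative (\<lambda>h. G' (h *\<^sub>R e) \<bullet> e)) (at 0)"
        by (rule has_derivative_inner_left[OF 1])
      moreover have "G' (h *\<^sub>R e) = h *\<^sub>R G' e" for h
        using G by (simp add: has_derivative_linear linear_cmul)
      ultimately show "((\<lambda>t. G (p + t *\<^sub>R e) \<bullet> e) has_real_derivative G' e \<bullet> e) (at 0)"
        by (simp add: has_field_derivative_def mult_commute_abs)
    qed
  qed
  from *[of 1] *[of "\<i>"] lap show False by simp
qed

section \<open>The cusp metric\<close>

definition cusp_density :: "complex \<Rightarrow> real" where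
  "cusp_density z = - 1 / (cmod z * ln (cmod z))"

lemma cusp_metric_eq: "cusp_metric p v w = (cusp_density p)\<^sup>2 * (v \<bullet> w)"
  by (simp add: cusp_metric_def conformal_metric_def cusp_density_def)

lemma cusp_density_pos: "p \<in> punctured_disc \<Longrightarrow> cusp_density p > 0"
  by (simp add: cusp_density_def punctured_disc_def divide_neg_neg mult_pos_neg)

text \<open>The exponent \<open>u\<close> for which \<open>e\<^sup>u |dz|\<close> is the cusp metric.\<close>

definition cusp_potential :: "complex \<Rightarrow> real" where
  "cusp_potential z = - ln (cmod z) - ln (- ln (cmod z))"

lemma exp_cusp_potential: "z \<in> punctured_disc \<Longrightarrow> exp (cusp_potential z) = cusp_density z"
  by (simp add: cusp_potential_def cusp_density_def punctured_disc_def exp_diff exp_minus field_simps)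

lemma open_punctured_disc: "open punctured_disc"
  unfolding punctured_disc_def by (intro open_Collect_conj open_Collect_less continuous_intros)

lemma cusp_potential_has_derivative:
  assumes "z \<in> punctured_disc"
  shows "(cusp_potential has_derivative
     (\<lambda>h. (- ((1 + 1 / ln (cmod z)) / (cmod z)\<^sup>2) *\<^sub>R z) \<bullet> h)) (at z)"
proof -
  have z: "z \<noteq> 0" "0 < cmod z" "ln (cmod z) < 0" using assms by (auto simp: punctured_disc_def)
  have n: "(cmod has_derivative (\<lambda>h. h \<bullet> sgn z)) (at z)"
    using has_derivative_norm[OF z(1)] by simp
  have "((\<lambda>r. - ln r - ln (- ln r)) has_real_derivative
      - (1 + 1 / ln (cmod z)) / cmod z) (at (cmod z))"
    using z by (auto intro!: derivative_eq_intros simp: field_simps)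
  from DERIV_compose_FDERIV[OF this n]
  have "(cusp_potential has_derivative (\<lambda>h. (h \<bullet> sgn z) * (- (1 + 1 / ln (cmod z)) / cmod z))) (at z)"
    by (simp add: cusp_potential_def[abs_def])
  moreover have "(h \<bullet> sgn z) * (- s / cmod z) = (- (s / (cmod z)\<^sup>2) *\<^sub>R z) \<bullet> h" for h s
    by (simp add: sgn_div_norm inner_commute divide_inverse power2_eq_square)
  ultimately show ?thesis by (simp only:)
qed

section \<open>The curve\<close>

text \<open>Smoothness of the loop is inherited from a holomorphic extension of the parametrisation to a
  complex neighbourhood of the real line.\<close>

lemma velocity_funpow_holomorphic:
  assumes f: "f holomorphic_on S" and S: "open S" "\<And>t::real. of_real t \<in> S"
  shows "(velocity ^^ k) (\<lambda>t. f (of_real t)) = (\<lambda>t. (deriv ^^ k) f (of_real t))"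
proof (induction k)
  case (Suc k)
  have "((\<lambda>t. (deriv ^^ k) f (of_real t)) has_vector_derivative (deriv ^^ Suc k) f (of_real t)) (at t)" for t
    by (rule has_vector_derivative_real_field[OF has_field_derivative_higher_deriv[OF f S]])
  then have "velocity (\<lambda>t. (deriv ^^ k) f (of_real t)) = (\<lambda>t. (deriv ^^ Suc k) f (of_real t))"
    unfolding velocity_def by (intro ext vector_derivative_at)
  then show ?case by (simp add: Suc)
qed simp

text \<open>The loop is \<open>log |z| = - depth (arg z)\<close>. Its total curvature is the integral of \<open>1 / depth\<close>, so the
  reciprocal is chosen to be a trigonometric polynomial, \<open>5 / 4 + cos\<close>. The mean \<open>5 / 4\<close> exceeds 1,
  which makes the total curvature exceed \<open>2 \<pi>\<close>; the minimum \<open>1 / 4\<close> is so small that the loop comes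
  close to the cusp in the direction \<open>arg z = \<pi>\<close>. The primed functions are the first and second
  derivatives.\<close>

definition depth :: "real \<Rightarrow> real" where "depth x = 4 / (5 + 4 * cos x)"

definition depth' :: "real \<Rightarrow> real" where "depth' x = 16 * sin x / (5 + 4 * cos x)\<^sup>2"

definition depth'' :: "real \<Rightarrow> real" where
  "depth'' x = 16 * cos x / (5 + 4 * cos x)\<^sup>2 + 128 * (sin x)\<^sup>2 / (5 + 4 * cos x)^3"

lemma five_plus_four_cos: "1 \<le> 5 + 4 * cos x" "5 + 4 * cos x \<le> 9" for x :: real
  using cos_ge_minus_one[of x] cos_le_one[of x] by linarith+

lemma depth_bounds: "0 < depth x" "4 / 9 \<le> depth x" "depth x \<le> 4"
  using five_plus_four_cos[of x] by (auto simp: depth_def field_simps)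

lemma has_field_derivative_depth [derivative_intros]:
  assumes "(f has_real_derivative f') (at x within S)"
  shows "((\<lambda>x. depth (f x)) has_real_derivative depth' (f x) * f') (at x within S)"
  using five_plus_four_cos[of "f x"] unfolding depth_def depth'_def
  by (auto intro!: derivative_eq_intros assms simp: power2_eq_square)

lemma has_field_derivative_depth' [derivative_intros]:
  assumes "(f has_real_derivative f') (at x within S)"
  shows "((\<lambda>x. depth' (f x)) has_real_derivative depth'' (f x) * f') (at x within S)"
proof -
  have D: "5 + 4 * cos (f x) \<noteq> 0" using five_plus_four_cos[of "f x"] by linarith
  have alg: "(16 * c * D\<^sup>2 + 16 * s * (2 * D * (4 * s))) / (D\<^sup>2 * D\<^sup>2)
      = 16 * c / D\<^sup>2 + 128 * s\<^sup>2 / D^3" if "D \<noteq> 0" for c s D :: real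
    using that by (simp add: add_divide_distrib eval_nat_numeral)
  have "(depth' has_real_derivative depth'' (f x)) (at (f x))"
    unfolding depth'_def[abs_def] depth''_def alg[OF D, symmetric]
    by (auto intro!: derivative_eq_intros simp: D power2_eq_square)
  from DERIV_chain2[OF this assms] show ?thesis .
qed

lemma continuous_on_depth [continuous_intros]:
  fixes f :: "'a::t2_space \<Rightarrow> real"
  assumes "continuous_on S f"
  shows "continuous_on S (\<lambda>x. depth (f x))"
proof -
  have "5 + 4 * cos (f x) \<noteq> 0" for x
    using five_plus_four_cos(1)[of "f x"] by linarith
  then show ?thesis
    unfolding depth_def by (intro continuous_intros assms ballI)
qed

lemma has_vector_derivative_Complex:
  assumes "(f has_real_derivative f') (at t within S)" "(g has_real_derivative g') (at t within S)"
  shows "((\<lambda>t. Complex (f t) (g t)) has_vector_derivative Complex f' g') (at t within S)"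
proof -
  have "((\<lambda>t. f t *\<^sub>R 1 + g t *\<^sub>R \<i>) has_vector_derivative f' *\<^sub>R 1 + g' *\<^sub>R \<i>) (at t within S)"
    using assms by (auto intro!: derivative_eq_intros)
  then show ?thesis by (simp add: Complex_eq scaleR_conv_of_real mult.commute)
qed

text \<open>A lift of the loop under the exponential map. In logarithmic coordinates the loop is a graph over
  the imaginary axis, and both its geometry and its two sides become transparent.\<close>

definition loop_log :: "real \<Rightarrow> complex" where
  "loop_log t = Complex (- depth (2 * pi * t)) (2 * pi * t)"

definition loop_log' :: "real \<Rightarrow> complex" where
  "loop_log' t = Complex (- (2 * pi * depth' (2 * pi * t))) (2 * pi)"

definition loop_log'' :: "real \<Rightarrow> complex" where
  "loop_log'' t = Complex (- ((2 * pi)\<^sup>2 * depth'' (2 * pi * t))) 0"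

definition loop :: "real \<Rightarrow> complex" where "loop t = exp (loop_log t)"

lemma loop_log_has_vector_derivative:
  "(loop_log has_vector_derivative loop_log' t) (at t within S)"
  unfolding loop_log_def[abs_def] loop_log'_def
  by (rule has_vector_derivative_Complex)
     (auto intro!: derivative_eq_intros)

lemma loop_log'_has_vector_derivative:
  "(loop_log' has_vector_derivative loop_log'' t) (at t within S)"
  unfolding loop_log'_def[abs_def] loop_log''_def
  by (rule has_vector_derivative_Complex)
     (auto intro!: derivative_eq_intros simp: power2_eq_square)

lemma loop_has_vector_derivative:
  "(loop has_vector_derivative loop_log' t * loop t) (at t within S)"
  using field_vector_diff_chain_within[OF loop_log_has_vector_derivative, of exp "exp (loop_log t)" t S]
  by (simp add: loop_def[abs_def] o_def DERIV_exp has_field_derivative_at_within)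

lemma velocity_loop: "velocity loop = (\<lambda>t. loop_log' t * loop t)"
  unfolding velocity_def using loop_has_vector_derivative by (auto intro!: vector_derivative_at)

lemma velocity_velocity_loop:
  "velocity (velocity loop) t = (loop_log'' t + (loop_log' t)\<^sup>2) * loop t"
  unfolding velocity_loop unfolding velocity_def
  by (rule vector_derivative_at)
     (auto intro!: derivative_eq_intros loop_has_vector_derivative loop_log'_has_vector_derivative
       simp: algebra_simps power2_eq_square)

lemma Im_loop_log' [simp]: "Im (loop_log' t) = 2 * pi"
  by (simp add: loop_log'_def)

lemma loop_nonzero [simp]: "loop t \<noteq> 0"
  by (simp add: loop_def)

lemma loop_log'_nonzero [simp]: "loop_log' t \<noteq> 0"
  using Im_loop_log'[of t] by (metis pi_neq_zero mult_eq_0_iff zero_neq_numeral zero_complex.sel(2))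

lemma cmod_loop: "cmod (loop t) = exp (- depth (2 * pi * t))"
  by (simp add: loop_def loop_log_def norm_exp_eq_Re)

lemma loop_in_punctured_disc: "loop t \<in> punctured_disc"
  using depth_bounds[of "2 * pi * t"] by (simp add: punctured_disc_def cmod_loop)

lemma loop_polar: "loop t = of_real (exp (- depth (2 * pi * t))) * exp (2 * of_real pi * \<i> * of_real t)"
  unfolding loop_def loop_log_def exp_of_real[symmetric] mult_exp_exp
  by (rule arg_cong[where f = exp]) (simp add: complex_eq_iff)

lemma depth_plus_of_int: "depth (2 * pi * (t + of_int n)) = depth (2 * pi * t)"
proof -
  have "cos (2 * pi * (t + of_int n)) = cos (2 * pi * t)"
    by (simp add: cos_add distrib_left sin_int_2pin cos_int_2pin)
  then show ?thesis by (simp add: depth_def)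
qed

lemma loop_plus_of_int: "loop (t + of_int n) = loop t"
  unfolding loop_def loop_log_def depth_plus_of_int exp_eq
  by (rule exI[of _ n]) (simp add: complex_eq_iff algebra_simps)

lemma loop_eq_iff: "loop s = loop t \<longleftrightarrow> s - t \<in> \<int>"
proof
  assume "loop s = loop t"
  then obtain n :: int where "loop_log s = loop_log t + of_int (2 * n) * pi * \<i>"
    unfolding loop_def exp_eq by blast
  then have "Im (loop_log s) = Im (loop_log t) + 2 * of_int n * pi" by simp
  then have "2 * pi * (s - t) = 2 * pi * of_int n" by (simp add: loop_log_def algebra_simps)
  then have "s - t = of_int n" by simp
  then show "s - t \<in> \<int>" by simp
next
  assume "s - t \<in> \<int>"
  then obtain n where "s = t + of_int n" by (metis Ints_cases add.commute diff_add_cancel)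
  then show "loop s = loop t" by (simp add: loop_plus_of_int)
qed

lemma loop_eq_holomorphic:
  "loop = (\<lambda>t. (\<lambda>w. exp (2 * of_real pi * \<i> * w - 4 / (5 + 4 * cos (2 * of_real pi * w)))) (of_real t))"
proof
  fix t :: real
  have c: "cos (2 * of_real pi * of_real t :: complex) = of_real (cos (2 * pi * t))"
    by (simp flip: cos_of_real)
  have "loop_log t = 2 * of_real pi * \<i> * of_real t - of_real (depth (2 * pi * t))"
    by (simp add: loop_log_def complex_eq_iff)
  then show "loop t = (\<lambda>w. exp (2 * of_real pi * \<i> * w - 4 / (5 + 4 * cos (2 * of_real pi * w)))) (of_real t)"
    by (simp add: loop_def depth_def c)
qed

lemma path_loop: "path loop"
  unfolding path_def
  using loop_has_vector_derivative has_vector_derivative_continuous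
  by (metis continuous_on_eq_continuous_within)

lemma smooth_simple_closed_curve_loop: "smooth_simple_closed_curve loop"
  unfolding smooth_simple_closed_curve_def
proof (intro conjI allI)
  fix t show "loop (t + 1) = loop t" using loop_plus_of_int[of t 1] by simp
  show "velocity loop t \<noteq> 0" by (simp add: velocity_loop)
next
  fix k t
  let ?F = "\<lambda>w. exp (2 * of_real pi * \<i> * w - 4 / (5 + 4 * cos (2 * of_real pi * w)))"
  let ?S = "{w::complex. 5 + 4 * cos (2 * of_real pi * w) \<noteq> 0}"
  have S: "open ?S"
    by (intro open_Collect_neq continuous_intros)
  have F: "?F holomorphic_on ?S"
    by (intro holomorphic_intros) auto
  have R: "of_real t \<in> ?S" for t :: real
  proof -
    have "(5 + 4 * cos (2 * of_real pi * of_real t) :: complex) = of_real (5 + 4 * cos (2 * pi * t))"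
      by (simp flip: cos_of_real)
    also have "\<dots> \<noteq> 0" using five_plus_four_cos(1)[of "2 * pi * t"] by (smt (verit) of_real_eq_0_iff)
    finally show ?thesis by simp
  qed
  have "((\<lambda>t. (deriv ^^ k) ?F (of_real t)) has_vector_derivative (deriv ^^ Suc k) ?F (of_real t)) (at t)"
    by (rule has_vector_derivative_real_field[OF has_field_derivative_higher_deriv[OF F S R]])
  then show "(velocity ^^ k) loop differentiable at t"
    unfolding loop_eq_holomorphic velocity_funpow_holomorphic[OF F S R]
    by (rule differentiableI_vector)
next
  show "simple_path loop"
  proof (rule simple_pathI[OF path_loop])
    fix x y :: real assume "0 \<le> x" "x < y" "y \<le> 1" "loop x = loop y"
    then obtain n :: int where "x - y = of_int n" unfolding loop_eq_iff using Ints_cases by blast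
    moreover have "n = -1" using calculation \<open>0 \<le> x\<close> \<open>x < y\<close> \<open>y \<le> 1\<close> by linarith
    ultimately show "x = 0 \<and> y = 1" using \<open>0 \<le> x\<close> \<open>y \<le> 1\<close> by auto
  qed
qed

lemma cusp_potential_loop: "cusp_potential (loop t) = depth (2 * pi * t) - ln (depth (2 * pi * t))"
  by (simp add: cusp_potential_def cmod_loop)

section \<open>The homology class of the curve\<close>

lemma chain_map_path_chain: "chain_map 1 f (path_chain p) = path_chain (f \<circ> p)"
  unfolding path_chain_def
  by (auto simp: chain_map_def simplex_map_def fun_eq_iff restrict_def intro!: arg_cong[where f = frag_of])

lemma singular_relcycle_path_chain:
  assumes p: "path p" "path_image p \<subseteq> S" "pathfinish p = pathstart p"
  shows "singular_relcycle 1 (top_of_set S) {} (path_chain p)"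
proof -
  have x1: "x 1 \<in> {0..1}" if "x \<in> standard_simplex 1" for x
    using that by (auto simp: standard_simplex_def)
  let ?T = "subtopology (powertop_real UNIV) (standard_simplex 1)"
  have "continuous_map ?T (top_of_set {0..1::real}) (\<lambda>x. x 1)"
    using x1 by (auto simp: continuous_map_in_subtopology
        intro!: continuous_map_from_subtopology continuous_map_product_projection)
  moreover have "continuous_map (top_of_set {0..1}) (top_of_set S) p"
    using p by (auto simp: path_def path_image_def)
  ultimately have "continuous_map ?T (top_of_set S) (p \<circ> (\<lambda>x. x 1))"
    by (rule continuous_map_compose)
  then have "continuous_map ?T (top_of_set S) (restrict (\<lambda>x. p (x 1)) (standard_simplex 1))"
    by (rule continuous_map_eq) (auto simp: topspace_standard_simplex)
  then have 1: "singular_chain 1 (top_of_set S) (path_chain p)"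
    by (simp add: path_chain_def singular_chain_of singular_simplex_def)
  \<comment> \<open>The two ends of a closed path are the same singular 0-simplex, and so the path is a cycle.\<close>
  have "singular_face 1 0 (restrict (\<lambda>x. p (x 1)) (standard_simplex 1)) =
        singular_face 1 1 (restrict (\<lambda>x. p (x 1)) (standard_simplex 1))"
  proof -
    have face: "simplical_face k x \<in> standard_simplex 1" if "x \<in> standard_simplex 0" "k \<le> 1" for k x
      using simplical_face_in_standard_simplex[of 1 k x] that by simp
    have coord: "simplical_face 0 x 1 = x 0" "simplical_face 1 x 1 = 0" for x :: "nat \<Rightarrow> real"
      by (auto simp: simplical_face_def)
    have "p 1 = p 0" using p(3) by (simp add: pathfinish_def pathstart_def)
    have "restrict (\<lambda>x. p (x 1)) (standard_simplex 1) (simplical_face 0 x) =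
        restrict (\<lambda>x. p (x 1)) (standard_simplex 1) (simplical_face 1 x)"
      if "x \<in> standard_simplex 0" for x
    proof -
      have "simplical_face 0 x \<in> standard_simplex 1" "simplical_face 1 x \<in> standard_simplex 1" "x 0 = 1"
        using face[OF that] that by (auto simp: standard_simplex_def)
      then show ?thesis
        using \<open>p 1 = p 0\<close> coord by (simp only: restrict_apply if_True)
    qed
    then show ?thesis
      by (auto simp: singular_face_def restrict_def)
  qed
  then have "chain_boundary 1 (path_chain p) = 0"
    by (simp add: path_chain_def chain_boundary_of)
  with 1 show ?thesis by (simp add: singular_cycle)
qed

text \<open>Homotopy invariance of homology is a statement on maps between spaces. It applies to two closed
  paths once they are written as the images of one cycle under homotopic maps; here the homotopy runs
  along straight segments.\<close>

lemma homologous_in_of_segments: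
  fixes f g :: "complex \<Rightarrow> complex"
  assumes p: "path p" "path_image p \<subseteq> C" "pathfinish p = pathstart p"
    and f: "continuous_on C f" and g: "continuous_on C g"
    and seg: "\<And>z. z \<in> C \<Longrightarrow> closed_segment (f z) (g z) \<subseteq> S"
  shows "homologous_in S (f \<circ> p) (g \<circ> p)"
proof -
  have "homotopic_with (\<lambda>h. h \<in> {} \<rightarrow> {}) (top_of_set C) (top_of_set S) f g"
    using homotopic_with_linear[OF f g seg] by simp
  from homotopic_imp_homologous_rel_chain_maps[OF this singular_relcycle_path_chain[OF p]]
  show ?thesis by (simp add: homologous_in_def flip: chain_map_path_chain)
qed

text \<open>The loop and the circle are the images of the unit circle under two maps that preserve arguments;
  the segments between corresponding points are radial and avoid 0.\<close>

lemma homologous_in_loop_circlepath: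
  assumes r: "0 < r" "r < 1"
  shows "homologous_in punctured_disc loop (circlepath 0 r)"
proof -
  define f where "f z = of_real (exp (- 4 / (5 + 4 * Re z))) * z" for z
  have ne: "5 + 4 * Re z \<ge> 1" if "z \<in> sphere 0 1" for z
    using abs_Re_le_cmod[of z] that by auto
  have loop: "loop = f \<circ> circlepath 0 1"
    by (auto simp: fun_eq_iff loop_polar f_def circlepath depth_def Re_exp mult_ac)
  have circ: "circlepath 0 r = (\<lambda>z. of_real r * z) \<circ> circlepath 0 1"
    by (auto simp: fun_eq_iff circlepath)
  show ?thesis unfolding loop circ
  proof (rule homologous_in_of_segments[where C = "sphere 0 1"])
    show "continuous_on (sphere 0 1) f" unfolding f_def
      using ne by (intro continuous_intros) force
    fix z :: complex assume z: "z \<in> sphere 0 1"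
    show "closed_segment (f z) (of_real r * z) \<subseteq> punctured_disc"
    proof
      fix w assume "w \<in> closed_segment (f z) (of_real r * z)"
      then obtain a where a: "0 \<le> a" "a \<le> 1" "w = (1 - a) *\<^sub>R f z + a *\<^sub>R (of_real r * z)"
        by (auto simp: in_segment)
      define e where "e = exp (- 4 / (5 + 4 * Re z))"
      have e: "0 < e" "e < 1" using ne[OF z] by (auto simp: e_def)
      have w: "w = of_real ((1 - a) * e + a * r) * z"
        by (simp add: a(3) f_def e_def scaleR_conv_of_real algebra_simps)
      have "0 < (1 - a) * e + a * r"
        using a e r by (smt (verit) mult_nonneg_nonneg mult_pos_pos)
      moreover have "(1 - a) * e + a * r < 1"
        using convex_bound_lt[of e 1 r "1 - a" a] a e r by simp
      ultimately show "w \<in> punctured_disc"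
        using z by (auto simp add: w punctured_disc_def norm_mult simp del: of_real_add of_real_mult of_real_diff)
    qed
  next
    show "continuous_on (sphere 0 1) (\<lambda>z::complex. of_real r * z)"
      by (rule continuous_on_mult_left) (rule continuous_on_id)
  qed simp_all
qed

section \<open>The side of the cusp and the normal\<close>

text \<open>In logarithmic coordinates, the signed distance to the loop in the direction of the real axis. It is
  written in terms of \<open>z\<close> itself so that it is visibly single valued and continuous off 0.\<close>

definition height :: "complex \<Rightarrow> real" where
  "height z = ln (cmod z) + 4 / (5 + 4 * (Re z / cmod z))"

lemma height_exp: "height (exp w) = Re w + depth (Im w)"
  by (simp add: height_def depth_def norm_exp_eq_Re Re_exp)

lemma height_loop: "height (loop t) = 0"
  by (simp add: loop_def height_exp loop_log_def)

lemma continuous_on_height: "continuous_on (- {0}) height"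
proof -
  have "5 + 4 * (Re z / cmod z) \<noteq> 0" if "z \<noteq> 0" for z
  proof -
    have "0 < cmod z" "- 1 * cmod z \<le> Re z" using that abs_Re_le_cmod[of z] by (simp, linarith)
    then have "- 1 \<le> Re z / cmod z" by (simp only: pos_le_divide_eq)
    then show ?thesis by linarith
  qed
  then show ?thesis unfolding height_def by (intro continuous_intros) auto
qed

lemma height_bounds:
  assumes "z \<noteq> 0" shows "ln (cmod z) + 4 / 9 \<le> height z" "height z \<le> ln (cmod z) + 4"
proof -
  have "height z = Re (Ln z) + depth (Im (Ln z))" using assms height_exp[of "Ln z"] by simp
  then show "ln (cmod z) + 4 / 9 \<le> height z" "height z \<le> ln (cmod z) + 4"
    using depth_bounds[of "Im (Ln z)"] assms by (simp_all)
qed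

lemma path_image_loop: "path_image loop = {z. z \<noteq> 0 \<and> height z = 0}"
proof (intro equalityI subsetI)
  fix z assume "z \<in> {z. z \<noteq> 0 \<and> height z = 0}"
  then have z: "z \<noteq> 0" "height z = 0" by auto
  \<comment> \<open>The parameter is the principal argument in units of \<open>2 \<pi>\<close>, shifted to \<open>[0, 1)\<close> by periodicity.\<close>
  define t where "t = Im (Ln z) / (2 * pi)"
  have "Re (Ln z) + depth (Im (Ln z)) = 0" using z height_exp[of "Ln z"] by simp
  then have "loop_log t = Ln z" by (simp add: loop_log_def t_def complex_eq_iff)
  then have "z = loop t" using z by (simp add: loop_def)
  also have "\<dots> = loop (frac t)"
    using loop_plus_of_int[of "frac t" "\<lfloor>t\<rfloor>"] by (simp add: frac_def)
  also have "\<dots> \<in> path_image loop"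
    using frac_ge_0[of t] frac_lt_1[of t] by (auto simp: path_image_def)
  finally show "z \<in> path_image loop" .
qed (auto simp: path_image_def height_loop)

definition below_loop :: "complex set" where "below_loop = {z. z \<noteq> 0 \<and> height z < 0}"

lemma open_below_loop: "open below_loop" and open_above_loop: "open {z. z \<noteq> 0 \<and> height z > 0}"
proof -
  have "open ((- {0}) \<inter> height -` {..<0})" "open ((- {0}) \<inter> height -` {0<..})"
    by (intro continuous_open_preimage[OF continuous_on_height] open_Compl closed_singleton open_lessThan open_greaterThan)+
  moreover have "(- {0}) \<inter> height -` {..<0} = below_loop" "(- {0}) \<inter> height -` {0<..} = {z. z \<noteq> 0 \<and> height z > 0}"
    by (auto simp: below_loop_def)
  ultimately show "open below_loop" "open {z. z \<noteq> 0 \<and> height z > 0}" by simp_all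
qed

lemma below_loop_subset: "below_loop \<subseteq> punctured_disc - path_image loop"
proof
  fix z assume "z \<in> below_loop"
  then have z: "z \<noteq> 0" "height z < 0" by (auto simp: below_loop_def)
  then have "ln (cmod z) < 0" using height_bounds(1)[OF z(1)] by linarith
  then show "z \<in> punctured_disc - path_image loop"
    using z by (simp add: punctured_disc_def path_image_loop)
qed

lemma connected_below_loop: "connected below_loop"
proof -
  define P where "P = (\<lambda>(a, b). exp (Complex (a - depth b) b))"
  have "below_loop = P ` ({..<0} \<times> UNIV)"
  proof (intro equalityI subsetI)
    fix z assume "z \<in> below_loop"
    then have z: "z \<noteq> 0" "height z < 0" by (auto simp: below_loop_def)
    have "Complex (height z - depth (Im (Ln z))) (Im (Ln z)) = Ln z"
      using z height_exp[of "Ln z"] by (simp add: complex_eq_iff)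
    then have "z = P (height z, Im (Ln z))"
      using z by (simp add: P_def)
    then show "z \<in> P ` ({..<0} \<times> UNIV)" using z by blast
  qed (auto simp: below_loop_def P_def height_exp)
  moreover have "continuous_on ({..<0} \<times> UNIV) P"
    unfolding P_def Complex_eq case_prod_unfold by (intro continuous_intros)
  moreover have "connected ({..<0} \<times> UNIV :: (real \<times> real) set)"
    by (intro convex_connected convex_Times) auto
  ultimately show ?thesis using connected_continuous_image by metis
qed

lemma small_in_below_loop:
  assumes "z \<noteq> 0" "cmod z < exp (-4)"
  shows "z \<in> below_loop"
proof -
  have "ln (cmod z) < ln (exp (-4))" using assms by (subst ln_less_cancel_iff) auto
  then show ?thesis using assms(1) height_bounds(2)[of z] by (simp add: below_loop_def)
qed

text \<open>The loop cuts the punctured disc into the open sets \<open>height < 0\<close> and \<open>height > 0\<close>. The former is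
  connected, being swept out by the radial segments below the loop, so it is a whole component. It
  contains a punctured neighbourhood of 0 and is thus the only component adjacent to 0.\<close>

lemma cusp_side_loop: "cusp_side loop = below_loop"
  unfolding cusp_side_def
proof (rule the_equality)
  have small: "of_real r \<in> below_loop" if "0 < r" "r < exp (-4)" for r
    by (rule small_in_below_loop) (use that in auto)
  have comp: "below_loop \<in> components (punctured_disc - path_image loop)"
    unfolding in_components_maximal
  proof (intro conjI allI impI below_loop_subset connected_below_loop)
    show "below_loop \<noteq> {}" using small[of "exp (-5)"] by auto
    fix D assume D: "D \<noteq> {} \<and> below_loop \<subseteq> D \<and> D \<subseteq> punctured_disc - path_image loop \<and> connected D"
    let ?B = "{z. z \<noteq> 0 \<and> height z > 0}"
    have "D \<subseteq> below_loop \<union> ?B"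
      using D by (force simp: below_loop_def path_image_loop punctured_disc_def)
    moreover have "below_loop \<inter> ?B \<inter> D = {}" by (auto simp: below_loop_def)
    ultimately have "below_loop \<inter> D = {} \<or> ?B \<inter> D = {}"
      using D connectedD[OF _ open_below_loop open_above_loop] by blast
    then show "D = below_loop"
      using D \<open>D \<subseteq> _\<close> \<open>below_loop \<noteq> {}\<close> by blast
  qed
  have "0 \<in> closure below_loop"
    unfolding closure_approachable
  proof (intro allI impI)
    fix e :: real assume e: "e > 0"
    define r where "r = min e (exp (-4)) / 2"
    have "0 < r" "r < e" "r < exp (-4)" using e by (auto simp: r_def min_def)
    then show "\<exists>y\<in>below_loop. dist y 0 < e"
      by (intro bexI[OF _ small[of r]]) auto
  qed
  with comp show "below_loop \<in> components (punctured_disc - path_image loop) \<and> 0 \<in> closure below_loop"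
    by simp
  fix A assume A: "A \<in> components (punctured_disc - path_image loop) \<and> 0 \<in> closure A"
  then obtain y where y: "y \<in> A" "cmod y < exp (-4)"
    unfolding closure_approachable using exp_gt_zero[of "-4::real"] by (metis dist_0_norm dist_commute)
  have "y \<noteq> 0" using A y in_components_subset by (fastforce simp: punctured_disc_def)
  then have "y \<in> below_loop" using y small_in_below_loop by blast
  then show "A = below_loop"
    using A comp y components_nonoverlap by blast
qed

text \<open>A vector at \<open>loop t\<close> is given here by its quotient \<open>m\<close> by \<open>loop t\<close>, that is, in logarithmic
  coordinates. The number \<open>c\<close> is the derivative of the height in that direction, and its sign decides
  to which side of the loop the vector points.\<close>

lemma loop_direction:
  fixes m :: complex and t :: real
  defines "c \<equiv> Re m + depth' (2 * pi * t) * Im m"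
  shows "c < 0 \<Longrightarrow> \<forall>\<^sub>F \<epsilon> in at_right 0. loop t + \<epsilon> *\<^sub>R (loop t * m) \<in> below_loop"
    and "c > 0 \<Longrightarrow> \<forall>\<^sub>F \<epsilon> in at_right 0. loop t + \<epsilon> *\<^sub>R (loop t * m) \<notin> below_loop"
proof -
  define L where "L \<epsilon> = loop_log t + Ln (1 + of_real \<epsilon> * m)" for \<epsilon> :: real
  define \<psi> where "\<psi> \<epsilon> = Re (L \<epsilon>) + depth (Im (L \<epsilon>))" for \<epsilon>
  have L: "(L has_vector_derivative m) (at 0)"
  proof -
    have "((\<lambda>z. loop_log t + Ln (1 + z * m)) has_field_derivative m) (at (of_real 0))"
      by (auto intro!: derivative_eq_intros)
    from has_vector_derivative_real_field[OF this] show ?thesis by (simp add: L_def[abs_def])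
  qed
  have "(Re \<circ> L has_vector_derivative Re m) (at 0)" "(Im \<circ> L has_vector_derivative Im m) (at 0)"
    using L bounded_linear.has_vector_derivative bounded_linear_Re bounded_linear_Im by (auto simp: o_def)
  then have ReIm: "((\<lambda>\<epsilon>. Re (L \<epsilon>)) has_real_derivative Re m) (at 0)"
      "((\<lambda>\<epsilon>. Im (L \<epsilon>)) has_real_derivative Im m) (at 0)"
    by (simp_all add: o_def has_real_derivative_iff_has_vector_derivative)
  have L0: "L 0 = loop_log t" by (simp add: L_def)
  have \<psi>: "(\<psi> has_real_derivative c) (at 0)"
    unfolding \<psi>_def[abs_def] c_def
    by (rule derivative_eq_intros ReIm refl)+ (simp add: L0 loop_log_def)
  have \<psi>0: "\<psi> 0 = 0" by (simp add: \<psi>_def L0 loop_log_def)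
  have "((\<lambda>\<epsilon>. 1 + of_real \<epsilon> * m) \<longlongrightarrow> 1 + of_real 0 * m) (at_right 0)"
    by (intro tendsto_intros)
  then have ne: "\<forall>\<^sub>F \<epsilon> in at_right 0. 1 + of_real \<epsilon> * m \<noteq> 0"
    by (rule tendsto_imp_eventually_ne) simp
  have eq: "loop t + \<epsilon> *\<^sub>R (loop t * m) = exp (L \<epsilon>)" if "1 + of_real \<epsilon> * m \<noteq> 0" for \<epsilon>
    using that by (simp add: L_def exp_add loop_def scaleR_conv_of_real algebra_simps)
  have iff: "loop t + \<epsilon> *\<^sub>R (loop t * m) \<in> below_loop \<longleftrightarrow> \<psi> \<epsilon> < 0" if "1 + of_real \<epsilon> * m \<noteq> 0" for \<epsilon>
    by (simp add: eq[OF that] below_loop_def height_exp \<psi>_def)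
  {
    assume "c < 0"
    then obtain d where "d > 0" "\<And>h. 0 < h \<Longrightarrow> h < d \<Longrightarrow> \<psi> h < 0"
      using DERIV_neg_dec_right[OF \<psi>] \<psi>0 by auto
    then have "\<forall>\<^sub>F \<epsilon> in at_right 0. \<psi> \<epsilon> < 0" by (auto simp: eventually_at_right_field)
    with ne show "\<forall>\<^sub>F \<epsilon> in at_right 0. loop t + \<epsilon> *\<^sub>R (loop t * m) \<in> below_loop"
      by eventually_elim (simp add: iff)
  next
    assume "c > 0"
    then obtain d where "d > 0" "\<And>h. 0 < h \<Longrightarrow> h < d \<Longrightarrow> \<psi> h > 0"
      using DERIV_pos_inc_right[OF \<psi>] \<psi>0 by auto
    then have "\<forall>\<^sub>F \<epsilon> in at_right 0. \<psi> \<epsilon> > 0" by (auto simp: eventually_at_right_field)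
    with ne show "\<forall>\<^sub>F \<epsilon> in at_right 0. loop t + \<epsilon> *\<^sub>R (loop t * m) \<notin> below_loop"
      by eventually_elim (simp add: iff)
  }
qed

text \<open>Multiplication by \<open>v\<close> is a similarity; complex quotients can therefore be used to compute the
  inner products in the geodesic curvature.\<close>

lemma inner_mult_left_mult: "(a * v) \<bullet> (b * v) = (cmod v)\<^sup>2 * (a \<bullet> b)" for a b v :: complex
  unfolding cmod_power2 by (simp add: inner_complex_def algebra_simps power2_eq_square)

lemma orthogonal_complex:
  assumes "n \<bullet> v = 0" "v \<noteq> 0" obtains k where "n = of_real k * (\<i> * v)"
proof -
  have "n = (n / v) * v" using assms by simp
  then have "(cmod v)\<^sup>2 * ((n / v) \<bullet> 1) = 0"
    using assms(1) inner_mult_left_mult[of "n / v" v 1] by simp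
  then have "Re (n / v) = 0" using assms(2) by simp
  then have "n / v = of_real (Im (n / v)) * \<i>" by (simp add: complex_eq_iff)
  then have "n = of_real (Im (n / v)) * (\<i> * v)"
    using assms(2) by (metis mult.assoc nonzero_eq_divide_eq)
  then show thesis by (rule that)
qed

text \<open>The loop runs counterclockwise around 0, so the normal towards the cusp is the velocity turned by
  \<open>\<i>\<close>. The only other unit vector orthogonal to the velocity is its negative, which leaves the cusp
  side.\<close>

lemma cusp_normal_loop:
  "cusp_normal loop t = of_real (1 / (cusp_density (loop t) * cmod (velocity loop t))) * (\<i> * velocity loop t)"
proof -
  define v where "v = velocity loop t"
  define \<rho> where "\<rho> = cusp_density (loop t)"
  have v: "v \<noteq> 0" and v_eq: "v = loop_log' t * loop t" by (simp_all add: v_def velocity_loop)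
  have \<rho>: "\<rho> > 0" unfolding \<rho>_def by (rule cusp_density_pos[OF loop_in_punctured_disc])
  define d where "d = 2 * pi * (1 + (depth' (2 * pi * t))\<^sup>2)"
  have d: "d > 0" unfolding d_def by (intro mult_pos_pos) (auto simp: add_pos_nonneg)
  have dir: "of_real k * (\<i> * v) = loop t * (of_real k * (\<i> * loop_log' t))" for k
    by (simp add: v_eq)
  \<comment> \<open>In logarithmic coordinates the turned velocity is a negative multiple of the gradient
    \<open>(1, depth')\<close> of the height, which gives the sum of squares in \<open>d\<close>.\<close>
  have dirc: "Re (of_real k * (\<i> * loop_log' t)) + depth' (2 * pi * t) * Im (of_real k * (\<i> * loop_log' t)) = - k * d" for k
    by (simp add: loop_log'_def d_def power2_eq_square algebra_simps)
  show ?thesis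
    unfolding cusp_normal_def v_def[symmetric] \<rho>_def[symmetric] cusp_side_loop cusp_metric_eq
  proof (rule the_equality)
    let ?N = "of_real (1 / (\<rho> * cmod v)) * (\<i> * v)"
    have "?N \<bullet> ?N = (1 / (\<rho> * cmod v))\<^sup>2 * (cmod v)\<^sup>2"
      unfolding dot_square_norm by (simp add: norm_mult norm_divide power_divide power_mult_distrib)
    then have "\<rho>\<^sup>2 * (?N \<bullet> ?N) = 1" using v \<rho> by (simp add: field_simps power2_eq_square)
    moreover have "?N \<bullet> v = 0"
      using inner_mult_left_mult[of "of_real (1 / (\<rho> * cmod v)) * \<i>" v 1] by (simp add: mult.assoc)
    moreover have "\<forall>\<^sub>F \<epsilon> in at_right 0. loop t + \<epsilon> *\<^sub>R ?N \<in> below_loop"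
      unfolding dir by (rule loop_direction(1)) (use v \<rho> d in \<open>simp only: dirc, simp\<close>)
    ultimately show "\<rho>\<^sup>2 * (?N \<bullet> ?N) = 1 \<and> \<rho>\<^sup>2 * (?N \<bullet> v) = 0 \<and>
        (\<forall>\<^sub>F \<epsilon> in at_right 0. loop t + \<epsilon> *\<^sub>R ?N \<in> below_loop)" by simp
  next
    fix n assume n: "\<rho>\<^sup>2 * (n \<bullet> n) = 1 \<and> \<rho>\<^sup>2 * (n \<bullet> v) = 0 \<and>
        (\<forall>\<^sub>F \<epsilon> in at_right 0. loop t + \<epsilon> *\<^sub>R n \<in> below_loop)"
    then have "n \<bullet> v = 0" using \<rho> by simp
    then obtain k where k: "n = of_real k * (\<i> * v)" using orthogonal_complex v by blast
    have "k \<ge> 0"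
    proof (rule ccontr)
      assume "\<not> k \<ge> 0"
      then have "- k * d > 0" using d by (simp add: mult_neg_pos)
      then have "\<forall>\<^sub>F \<epsilon> in at_right 0. loop t + \<epsilon> *\<^sub>R n \<notin> below_loop"
        unfolding k dir by (intro loop_direction(2)) (simp only: dirc)
      moreover have "\<forall>\<^sub>F \<epsilon> in at_right 0. loop t + \<epsilon> *\<^sub>R n \<in> below_loop" using n by blast
      ultimately have "\<forall>\<^sub>F \<epsilon> in at_right (0::real). False" by eventually_elim blast
      then show False by simp
    qed
    have "n \<bullet> n = (k * cmod v)\<^sup>2"
      unfolding dot_square_norm k by (simp add: norm_mult power_mult_distrib)
    with n have "(\<rho> * (k * cmod v))\<^sup>2 = 1" by (simp add: power_mult_distrib)
    then have "\<rho> * (k * cmod v) = 1"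
      using \<rho> \<open>k \<ge> 0\<close> by (auto simp: power2_eq_1_iff) (smt (verit) mult_nonneg_nonneg norm_ge_zero)
    then have "k = 1 / (\<rho> * cmod v)" using \<rho> v by (simp add: field_simps)
    then show "n = of_real (1 / (\<rho> * cmod v)) * (\<i> * v)" using k by simp
  qed
qed

section \<open>The total geodesic curvature\<close>

text \<open>The Euclidean part of the geodesic curvature is the rate of turning \<open>Im (\<gamma>'' / \<gamma>')\<close> of the tangent,
  where \<open>\<gamma>'' / \<gamma>' = l' / l + l\<close> for the logarithmic derivative \<open>l\<close> of the loop. The conformal
  factor contributes minus the derivative of its exponent along \<open>\<i> \<gamma>'\<close>. The terms \<open>2 \<pi>\<close> of the two
  parts cancel and leave \<open>2 \<pi> / depth\<close>, besides a term that integrates to 0 over a period.\<close>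

lemma curvature_integrand_loop:
  "geodesic_curvature cusp_metric loop (cusp_normal loop) t * speed cusp_metric loop t
     = 2 * pi / depth (2 * pi * t) + Im (loop_log'' t / loop_log' t)"
proof -
  define z where "z = loop t"
  define v where "v = velocity loop t"
  define l where "l = loop_log' t"
  define \<rho> where "\<rho> = cusp_density z"
  define s where "s = 1 + 1 / ln (cmod z)"
  define G where "G = (- (s / (cmod z)\<^sup>2)) *\<^sub>R z"
  define q where "q = loop_log'' t / l + l"
  have z: "z \<in> punctured_disc" "z \<noteq> 0" by (simp_all add: z_def loop_in_punctured_disc)
  have l: "l \<noteq> 0" "Im l = 2 * pi" by (simp_all add: l_def)
  have v: "v = l * z" "v \<noteq> 0" using l z by (simp_all add: v_def z_def l_def velocity_loop)
  have \<rho>: "\<rho> > 0" unfolding \<rho>_def by (rule cusp_density_pos[OF z(1)])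
  have acc: "velocity (velocity loop) t = q * v"
    using l by (simp add: velocity_velocity_loop q_def v l_def z_def field_simps power2_eq_square)
  have chr: "christoffel cusp_metric z v v = (G \<bullet> v) *\<^sub>R v + (G \<bullet> v) *\<^sub>R v - (v \<bullet> v) *\<^sub>R G"
    by (rule christoffel_conformal[OF open_punctured_disc z(1) _ cusp_potential_has_derivative[OF z(1), folded s_def, folded G_def]])
       (auto simp: fun_eq_iff cusp_metric_eq conformal_metric_def exp_cusp_potential)
  have iv: "v \<bullet> (\<i> * v) = 0" "(q * v) \<bullet> (\<i> * v) = (cmod v)\<^sup>2 * Im q"
    using inner_mult_left_mult[of 1 v \<i>] inner_mult_left_mult[of q v \<i>] by (simp_all add: inner_complex_def)
  have "G \<bullet> (\<i> * v) = - (s / (cmod z)\<^sup>2) * ((1 * z) \<bullet> ((\<i> * l) * z))"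
    by (simp add: G_def v mult.assoc)
  also have "\<dots> = s * (2 * pi)"
    unfolding inner_mult_left_mult using z l by (simp add: inner_complex_def)
  finally have Giv: "G \<bullet> (\<i> * v) = s * (2 * pi)" .
  have cov: "covariant_acceleration cusp_metric loop t \<bullet> (\<i> * v) = (cmod v)\<^sup>2 * (Im q - s * (2 * pi))"
    unfolding covariant_acceleration_def z_def[symmetric] v_def[symmetric] acc chr
    by (simp only: inner_add_left inner_diff_left inner_scaleR_left iv Giv dot_square_norm) (simp add: algebra_simps)
  have sp: "speed cusp_metric loop t = \<rho> * cmod v"
    using \<rho> by (simp add: speed_def cusp_metric_eq z_def[symmetric] v_def[symmetric] \<rho>_def[symmetric]
        dot_square_norm real_sqrt_mult)
  have N: "cusp_normal loop t = (1 / (\<rho> * cmod v)) *\<^sub>R (\<i> * v)"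
    by (simp add: cusp_normal_loop z_def v_def \<rho>_def scaleR_conv_of_real)
  have "geodesic_curvature cusp_metric loop (cusp_normal loop) t * speed cusp_metric loop t
      = \<rho>\<^sup>2 * ((1 / (\<rho> * cmod v)) * ((cmod v)\<^sup>2 * (Im q - s * (2 * pi)))) / (\<rho> * cmod v)\<^sup>2 * (\<rho> * cmod v)"
    unfolding geodesic_curvature_def sp N cusp_metric_eq inner_scaleR_right cov
    by (simp add: \<rho>_def z_def)
  also have "\<dots> = Im q - s * (2 * pi)"
    using \<rho> v(2) by (simp add: field_simps power2_eq_square)
  also have "s = 1 - 1 / depth (2 * pi * t)"
    by (simp add: s_def z_def cmod_loop)
  also have "Im q = Im (loop_log'' t / l) + 2 * pi" by (simp add: q_def l)
  finally show ?thesis by (simp add: l_def algebra_simps)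
qed

text \<open>The logarithmic derivative \<open>l\<close> of the loop stays in the upper half plane and is periodic, so the
  principal argument of \<open>l\<close> is a periodic antiderivative of \<open>Im (l' / l)\<close>. What remains is the
  integral of \<open>2 \<pi> (5 / 4 + cos (2 \<pi> t))\<close>.\<close>

lemma total_geodesic_curvature_loop: "total_geodesic_curvature loop = 5 / 2 * pi"
proof -
  define W where "W t = 5 / 2 * pi * t + sin (2 * pi * t) + Im (Ln (loop_log' t))" for t
  have "((\<lambda>t. 2 * pi / depth (2 * pi * t) + Im (loop_log'' t / loop_log' t)) has_integral (W 1 - W 0)) {0..1}"
  proof (rule fundamental_theorem_of_calculus)
    fix t :: real
    have "((Ln \<circ> loop_log') has_vector_derivative loop_log'' t * inverse (loop_log' t)) (at t within {0..1})"
    proof (rule field_vector_diff_chain_within[OF loop_log'_has_vector_derivative])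
      have "loop_log' t \<notin> \<real>\<^sub>\<le>\<^sub>0" using Im_loop_log'[of t] by (auto simp: complex_nonpos_Reals_iff simp del: Im_loop_log')
      then show "(Ln has_field_derivative inverse (loop_log' t)) (at (loop_log' t) within loop_log' ` {0..1})"
        using has_field_derivative_Ln has_field_derivative_at_within by blast
    qed
    from bounded_linear.has_vector_derivative[OF bounded_linear_Im this]
    have "((\<lambda>t. Im (Ln (loop_log' t))) has_real_derivative Im (loop_log'' t / loop_log' t)) (at t within {0..1})"
      by (simp add: o_def divide_inverse has_real_derivative_iff_has_vector_derivative)
    moreover have "((\<lambda>t. 5 / 2 * pi * t + sin (2 * pi * t)) has_real_derivative
        5 / 2 * pi + cos (2 * pi * t) * (2 * pi)) (at t within {0..1})"
      by (auto intro!: derivative_eq_intros)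
    ultimately have "(W has_real_derivative 5 / 2 * pi + cos (2 * pi * t) * (2 * pi) + Im (loop_log'' t / loop_log' t)) (at t within {0..1})"
      unfolding W_def[abs_def] using DERIV_add by fast
    moreover have "2 * pi / depth (2 * pi * t) = 5 / 2 * pi + cos (2 * pi * t) * (2 * pi)"
      using five_plus_four_cos(1)[of "2 * pi * t"] by (simp add: depth_def field_simps)
    ultimately show "(W has_vector_derivative 2 * pi / depth (2 * pi * t) + Im (loop_log'' t / loop_log' t)) (at t within {0..1})"
      by (simp add: has_real_derivative_iff_has_vector_derivative)
  qed simp
  moreover have "W 1 - W 0 = 5 / 2 * pi"
    by (simp add: W_def loop_log'_def depth'_def)
  ultimately show ?thesis
    unfolding total_geodesic_curvature_def curvature_integrand_loop by (simp add: integral_unique)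
qed

section \<open>The obstruction to a completion\<close>

text \<open>The function \<open>x - ln x\<close> of the depth is the potential of the cusp metric on the loop. It is convex,
  so its maximum is attained at one of the extreme depths 4 and 4/9; it is attained at 4. For
  \<open>ln (4 / y)\<close> the tangent of \<open>ln\<close> at 1 is a sufficient bound where \<open>y\<close> is at least 1, and a constant
  bound suffices for smaller \<open>y\<close>.\<close>

lemma depth_minus_ln_le:
  "depth x - ln (depth x) \<le> 4 - ln 4"
proof -
  define y where "y = depth x"
  have y: "0 < y" "4 / 9 \<le> y" "y \<le> 4" using depth_bounds[of x] by (auto simp: y_def)
  have "ln (4 / y) \<le> 4 - y"
  proof (cases "1 \<le> y")
    case True
    have "ln (4 / y) \<le> 4 / y - 1" using y by (intro ln_le_minus_one) simp
    also have "\<dots> = (4 - y) / y" using y by (simp add: field_simps)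
    also have "\<dots> \<le> 4 - y" using True y by (simp add: divide_le_eq mult_left_mono[of 1 y "4 - y", simplified])
    finally show ?thesis .
  next
    case False
    have "ln (4 / y) \<le> ln (3 * 3)" using y by (simp add: field_simps)
    also have "\<dots> = 2 * ln 3" by (subst ln_mult) auto
    also have "ln (3::real) \<le> ln (exp (3 / 2))"
    proof (subst ln_le_cancel_iff)
      show "(3::real) \<le> exp (3 / 2)"
        using exp_lower_Taylor_quadratic[of "3 / 2"] by (simp add: power2_eq_square)
    qed auto
    finally show ?thesis using False by simp
  qed
  then show ?thesis using y by (simp add: ln_div y_def)
qed

lemma deepest_point: "loop (1 / 2) = - of_real (exp (- 4))"
  by (simp add: loop_polar depth_def)

text \<open>Beyond the deepest point of the loop, the negative real axis meets the loop no more and leads to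
  infinity.\<close>

lemma outer_ray_not_inside:
  assumes "exp (- 4) \<le> r"
  shows "- of_real r \<notin> inside (path_image loop)"
proof (cases "r = exp (- 4)")
  case True
  have "- of_real r \<in> path_image loop"
    unfolding True deepest_point[symmetric] by (auto simp: path_image_def)
  then show ?thesis using inside_no_overlap[of "path_image loop"] by blast
next
  case False
  define Q where "Q = (\<lambda>s. - complex_of_real s) ` {exp (- 4)<..}"
  have "connected Q" unfolding Q_def
    by (intro connected_continuous_image continuous_intros connected_Ioi)
  have "Q \<subseteq> - path_image loop"
  proof
    fix z assume "z \<in> Q"
    then obtain s where s: "z = - of_real s" "exp (- 4) < s" by (auto simp: Q_def)
    have "0 < s" using s(2) exp_gt_zero[of "-4::real"] by linarith
    then have "height z = ln s + 4" by (simp add: height_def s(1))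
    moreover have "ln (exp (- 4)) < ln s" using s(2) \<open>0 < s\<close> by (subst ln_less_cancel_iff) auto
    ultimately show "z \<in> - path_image loop" by (simp add: path_image_loop)
  qed
  have r: "- of_real r \<in> Q" using assms False by (auto simp: Q_def)
  have "\<not> bounded Q"
  proof
    assume "bounded Q"
    then obtain B where B: "\<And>z. z \<in> Q \<Longrightarrow> cmod z \<le> B" unfolding bounded_iff by blast
    define s where "s = max B 1 + 1"
    have s: "B < s" "1 < s" by (auto simp: s_def)
    have "exp (- 4) < s" using s(2) exp_less_one_iff[of "-4::real"] by linarith
    then have "- of_real s \<in> Q" by (simp add: Q_def)
    from B[OF this] show False using s by simp
  qed
  then have "\<not> bounded (connected_component_set (- path_image loop) (- of_real r))"
    using connected_component_maximal[OF r \<open>connected Q\<close> \<open>Q \<subseteq> _\<close>] bounded_subset by blast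
  then show ?thesis by (simp add: inside_def)
qed

text \<open>Let \<open>u\<close> be the exponent of a completion. Negative curvature makes its Laplacian positive, so on the
  compact set \<open>K\<close> of all points on or below the loop it takes its maximum on the loop. There \<open>u\<close> is
  the cusp potential, hence the maximum is taken at the deepest point \<open>\<zeta>\<close>, of depth 4. As \<open>u\<close>
  is differentiable at \<open>\<zeta>\<close> and agrees with the cusp potential outside, its radial derivative at
  \<open>\<zeta>\<close> is that of the cusp potential, which decreases in the radius wherever the depth is
  larger than 1. So \<open>u\<close> increases from \<open>\<zeta>\<close> into \<open>K\<close>, against the choice of \<open>\<zeta>\<close>.\<close>

lemma no_negatively_curved_completion_loop: "\<not> negatively_curved_completion loop g"
proof
  assume "negatively_curved_completion loop g"
  then obtain u where u: "C2_on unit_disc u"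
      "\<And>p. p \<in> unit_disc \<Longrightarrow> g p = conformal_metric (\<lambda>z. exp (u z)) p"
    and outer: "\<And>p. p \<in> unit_disc - inside (path_image loop) \<Longrightarrow> g p = cusp_metric p"
    and neg: "\<And>p. p \<in> unit_disc \<Longrightarrow> gauss_curvature g p < 0"
    unfolding negatively_curved_completion_def by blast
  obtain G G' where G: "\<And>q. q \<in> unit_disc \<Longrightarrow> (u has_derivative (\<lambda>h. G q \<bullet> h)) (at q)"
    and G': "\<And>q. q \<in> unit_disc \<Longrightarrow> (G has_derivative G' q) (at q)"
    using C2_on_gradient[OF u(1)] by blast
  have op: "open unit_disc" unfolding unit_disc_def by (intro open_Collect_less continuous_intros)
  have sub: "G' p 1 \<bullet> 1 + G' p \<i> \<bullet> \<i> > 0" if "p \<in> unit_disc" for p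
    using neg[OF that] gauss_curvature_conformal[OF op that u(2) G G'[OF that]]
    by (simp add: divide_less_0_iff)
  \<comment> \<open>A completion determines its exponent wherever it is the cusp metric.\<close>
  have u_eq: "u p = cusp_potential p" if "p \<in> punctured_disc" "p \<notin> inside (path_image loop)" for p
  proof -
    have p: "p \<in> unit_disc" using that by (simp add: unit_disc_def punctured_disc_def)
    have "(exp (u p))\<^sup>2 = g p 1 1" using p u(2) by (simp add: conformal_metric_def)
    also have "\<dots> = (cusp_density p)\<^sup>2" using outer[of p] p that(2) by (simp add: cusp_metric_eq)
    finally have "exp (u p) = cusp_density p"
      using cusp_density_pos[OF that(1)] by (simp add: power2_eq_iff_nonneg)
    then have "exp (u p) = exp (cusp_potential p)" using exp_cusp_potential[OF that(1)] by simp
    then show ?thesis by simp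
  qed
  define a :: real where "a = exp (- 4)"
  have a: "0 < a" "a < 1" "ln a = - 4" by (simp_all add: a_def)
  define \<zeta> where "\<zeta> = - complex_of_real a"
  have \<zeta>: "\<zeta> = loop (1 / 2)" by (simp add: \<zeta>_def a_def deepest_point)
  have u_loop: "u (loop t) \<le> u \<zeta>" for t
  proof -
    have on: "u (loop t) = cusp_potential (loop t)" for t
    proof (rule u_eq[OF loop_in_punctured_disc])
      have "loop t \<in> path_image loop" by (simp add: path_image_loop height_loop)
      then show "loop t \<notin> inside (path_image loop)" using inside_no_overlap[of "path_image loop"] by blast
    qed
    show ?thesis
      using depth_minus_ln_le[of "2 * pi * t"]
      by (simp add: \<zeta> on cusp_potential_loop) (simp add: depth_def)
  qed
  define K where "K = insert 0 (below_loop \<union> path_image loop)"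
  have K_eq: "K = - {z. z \<noteq> 0 \<and> height z > 0}"
    by (auto simp: K_def below_loop_def path_image_loop)
  have K_sub: "K \<subseteq> unit_disc"
    using below_loop_subset loop_in_punctured_disc
    by (auto simp: K_def path_image_def unit_disc_def punctured_disc_def)
  have "bounded K"
    using K_sub by (intro boundedI[where B = 1]) (auto simp: unit_disc_def less_imp_le)
  then have "compact K"
    using open_above_loop by (simp add: compact_eq_bounded_closed K_eq closed_def)
  moreover have "continuous_on K u"
    using G K_sub has_derivative_continuous continuous_at_imp_continuous_on by blast
  ultimately obtain m where m: "m \<in> K" "\<And>z. z \<in> K \<Longrightarrow> u z \<le> u m"
    using continuous_attains_sup[of K u] K_def by blast
  have \<zeta>_max: "u z \<le> u \<zeta>" if "z \<in> K" for z
  proof -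
    have inner: "m \<notin> insert 0 below_loop"
    proof
      assume mb: "m \<in> insert 0 below_loop"
      have "ball 0 a \<subseteq> insert 0 below_loop"
      proof
        fix z :: complex assume "z \<in> ball 0 a"
        then show "z \<in> insert 0 below_loop"
          using small_in_below_loop[of z] by (cases "z = 0") (auto simp: a_def)
      qed
      moreover have "0 \<in> ball (0::complex) a" using a by simp
      ultimately have "insert 0 below_loop = below_loop \<union> ball 0 a" by blast
      then have "open (insert 0 below_loop)" by (simp only: open_Un open_below_loop open_ball)
      moreover have "insert 0 below_loop \<subseteq> unit_disc" using K_sub by (auto simp: K_def)
      ultimately obtain q where "q \<in> insert 0 below_loop" "u q > u m"
        using no_local_max_of_laplacian_pos[of "insert 0 below_loop" m u G "G' m"] mb G G' sub by blast
      moreover from this have "q \<in> K" by (auto simp: K_def)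
      ultimately show False using m(2)[of q] by linarith
    qed
    then obtain t where "m = loop t" using m(1) by (auto simp: K_def path_image_def)
    then show ?thesis using m(2)[OF that] u_loop[of t] by simp
  qed
  \<comment> \<open>Compare \<open>u\<close> with the cusp potential along the negative real axis, as functions of the radius.\<close>
  define h where "h r = u (- complex_of_real r)" for r
  define k where "k r = - ln r - ln (- ln r)" for r :: real
  define k' where "k' = - (3 / 4) / a"
  have "\<zeta> \<in> unit_disc" using a by (simp add: \<zeta>_def unit_disc_def)
  then have "(u has_derivative (\<lambda>h. G \<zeta> \<bullet> h)) (at (- complex_of_real a))"
    using G by (simp add: \<zeta>_def)
  then have "(h has_derivative (\<lambda>s. G \<zeta> \<bullet> (- of_real s))) (at a)"
    unfolding h_def[abs_def]
    by (rule has_derivative_compose[where g = u and f = "\<lambda>r. - complex_of_real r", rotated])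
       (auto intro!: derivative_eq_intros)
  then have h': "(h has_real_derivative - (G \<zeta> \<bullet> 1)) (at a)"
    unfolding has_field_derivative_def
    by (rule has_derivative_eq_rhs) (simp add: fun_eq_iff inner_complex_def)
  have k': "(k has_real_derivative k') (at a)"
    unfolding k_def[abs_def] k'_def using a by (auto intro!: derivative_eq_intros simp: field_simps)
  have hk: "h r = k r" if "a \<le> r" "r < 1" for r
  proof -
    have "- complex_of_real r \<in> punctured_disc" using a that by (simp add: punctured_disc_def)
    from u_eq[OF this outer_ray_not_inside] that a show ?thesis
      by (simp add: h_def k_def cusp_potential_def a_def)
  qed
  \<comment> \<open>Two differentiable functions that agree to the right of \<open>a\<close> have equal derivatives at \<open>a\<close>.\<close>
  have "- (G \<zeta> \<bullet> 1) = k'"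
  proof (rule ccontr)
    assume ne: "- (G \<zeta> \<bullet> 1) \<noteq> k'"
    have d: "((\<lambda>r. h r - k r) has_real_derivative - (G \<zeta> \<bullet> 1) - k') (at a)"
      by (rule DERIV_diff[OF h' k'])
    have "\<exists>d>0. \<forall>s>0. s < d \<longrightarrow> h (a + s) - k (a + s) \<noteq> h a - k a"
    proof (cases "- (G \<zeta> \<bullet> 1) - k' > 0")
      case True
      from DERIV_pos_inc_right[OF d True] show ?thesis by (metis less_irrefl)
    next
      case False
      with ne have "- (G \<zeta> \<bullet> 1) - k' < 0" by linarith
      from DERIV_neg_dec_right[OF d this] show ?thesis by (metis less_irrefl)
    qed
    then obtain d where d: "d > 0" "\<And>s. 0 < s \<Longrightarrow> s < d \<Longrightarrow> h (a + s) - k (a + s) \<noteq> h a - k a" by blast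
    define s where "s = min d (1 - a) / 2"
    have "0 < s" "s < d" "a + s < 1" using d a by (auto simp: s_def min_def field_simps)
    with d(2)[of s] hk[of a] hk[of "a + s"] a show False by simp
  qed
  moreover have "k' < 0" using a by (simp add: k'_def)
  ultimately have "- (G \<zeta> \<bullet> 1) < 0" by (simp only:)
  then obtain d where d: "d > 0" "\<And>s. 0 < s \<Longrightarrow> s < d \<Longrightarrow> h (a - s) > h a"
    using DERIV_neg_dec_left[OF h'] by blast
  define s where "s = min d a / 2"
  have s: "0 < s" "s < d" "s < a" using d a by (auto simp: s_def)
  have "- complex_of_real (a - s) \<in> below_loop"
    by (rule small_in_below_loop) (use s in \<open>auto simp: a_def simp del: of_real_diff\<close>)
  then have "h (a - s) \<le> u \<zeta>" using \<zeta>_max by (simp add: h_def K_def)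
  then show False using d(2)[OF s(1,2)] by (simp add: h_def \<zeta>_def)
qed

theorem theorem8:
  shows "\<exists>\<gamma> :: real \<Rightarrow> complex.
           smooth_simple_closed_curve \<gamma> \<and>
           path_image \<gamma> \<subseteq> punctured_disc \<and>
           (\<forall>r. 0 < r \<and> r < 1 \<longrightarrow> homologous_in punctured_disc \<gamma> (circlepath 0 r)) \<and>
           total_geodesic_curvature \<gamma> > 2 * pi \<and>
           \<not> (\<exists>g. negatively_curved_completion \<gamma> g)"
proof (intro exI[of _ loop] conjI allI impI)
  show "smooth_simple_closed_curve loop" by (rule smooth_simple_closed_curve_loop)
  show "path_image loop \<subseteq> punctured_disc" using loop_in_punctured_disc by (auto simp: path_image_def)
  show "homologous_in punctured_disc loop (circlepath 0 r)" if "0 < r \<and> r < 1" for r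
    using that by (simp add: homologous_in_loop_circlepath)
  show "total_geodesic_curvature loop > 2 * pi"
    using pi_gt_zero by (simp add: total_geodesic_curvature_loop)
  show "\<not> (\<exists>g. negatively_curved_completion loop g)"
    using no_negatively_curved_completion_loop by blast
qed

end
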